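(* Let $q$ be a prime power and $n$ a positive integer. Then $\kappa_{\leqslant 1}(n,n)=q$ if $q^2\leqslant n\leqslant q^2+q$, and $\kappa_{\leqslant 1}(n,n)=q+1$ if $n=q^2+q+1$.
   Context: $[n]=\{1,\ldots,n\}$. $\kappa_{\leqslant 1}(n,m)$ is the maximum $k$ such that there exists a family of $m$ pairwise distinct $k$-element subsets of $[n]$ any two of which share at most one element. *)

theory Defs
  imports "HOL-Number_Theory.Prime_Powers"
begin

definition almost_disjoint_family :: "nat \<Rightarrow> nat \<Rightarrow> nat \<Rightarrow> nat set set \<Rightarrow> bool" where
  "almost_disjoint_family n m k F \<longleftrightarrow>
     finite F \<and> card F = m \<and>
     (\<forall>A\<in>F. A \<subseteq> {1..n} \<and> card A = k) \<and>
     (\<forall>A\<in>F. \<forall>B\<in>F. A \<noteq> B \<longrightarrow> card (A \<inter> B) \<le> 1)"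

text \<open>
  For m \<ge> 1 only values k \<le> n occur in the set below, so its maximum exists as soon as
  it is nonempty; when m = n \<ge> 1 it contains 1, witnessed by the singletons. For m = 0,
  or when no family exists, \<^const>\<open>Max\<close> carries no information.
\<close>

definition kappa_le1 :: "nat \<Rightarrow> nat \<Rightarrow> nat" where
  "kappa_le1 n m = Max {k. \<exists>F. almost_disjoint_family n m k F}"

end

theory Submission
  imports Defs "HOL-Number_Theory.Residues" "HOL-Algebra.Algebraic_Closure"
begin

text \<open>
  The pairs of points inside the members of a family are pairwise distinct, so $n$ sets of size
  $k$ in $[n]$ force $k (k - 1) \<le> n - 1$; this gives both upper bounds. The lines of the affine
  and of the projective plane of order $q$ attain them.

  Coordinates for the planes come from the fixed points $S$ of $x \<mapsto> x^q$ in the algebraic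
  closure of the field with $p$ elements. There are $q$ of them: modulo the square of $X - a$,
  where $a$ is a root, $X^q - X = (X - a)^q - (X - a)$ is $-(X - a)$, so all roots of the split
  polynomial $X^q - X$ are simple. By the Frobenius identity $S$ is closed under addition and
  multiplication, and since it lies in an integral domain, the lines $y = m x + b$ over $S$ meet
  as lines in a plane should; inverses in $S$ are not needed.
\<close>

section \<open>Binomial theorem and Frobenius identity in commutative rings\<close>

lemma (in cring) binomial_expansion:
  assumes [simp]: "a \<in> carrier R" "b \<in> carrier R"
  shows "(a \<oplus> b) [^] (n::nat) =
    (\<Oplus>k\<in>{..n}. add_pow R (n choose k) (a [^] k \<otimes> b [^] (n - k)))"
proof (induction n)
  case 0
  show ?case by simp
next
  case (Suc n)
  define f where "f n k = add_pow R (n choose k) (a [^] k \<otimes> b [^] (n - k))" for n k :: nat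
  have [simp]: "f n k \<in> carrier R" for n k
    by (simp add: f_def)
  \<comment> \<open>Pascal's rule, term by term.\<close>
  have *: "f (Suc n) (Suc k) = f n k \<otimes> a \<oplus> f n (Suc k) \<otimes> b" if "k \<le> n" for k
  proof -
    have "f n (Suc k) \<otimes> b = add_pow R (n choose Suc k) (a [^] Suc k \<otimes> b [^] (n - k))"
    \<comment> \<open>At \<open>k = n\<close> the truncated exponent \<open>n - Suc k\<close> is too
      large by one after multiplying by \<open>b\<close>, but the coefficient
      \<open>n choose Suc n\<close> is 0.\<close>
    proof (cases "k = n")
      case True
      then show ?thesis by (simp add: f_def binomial_eq_0)
    next
      case False
      then have "n - k = Suc (n - Suc k)"
        using that by simp
      then show ?thesis
        by (simp add: f_def add_pow_ldistr m_assoc)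
    qed
    moreover have "f n k \<otimes> a = add_pow R (n choose k) (a [^] Suc k \<otimes> b [^] (n - k))"
      unfolding f_def by (subst add_pow_ldistr) (simp_all add: m_ac)
    ultimately show ?thesis
      by (simp add: f_def add.nat_pow_mult)
  qed
  have "(a \<oplus> b) [^] Suc n = (\<Oplus>k\<in>{..n}. f n k) \<otimes> (a \<oplus> b)"
    using Suc by (simp add: f_def)
  also have "\<dots> = (\<Oplus>k\<in>{..n}. f n k \<otimes> a) \<oplus> (\<Oplus>k\<in>{..n}. f n k \<otimes> b)"
    by (simp add: r_distr finsum_ldistr)
  \<comment> \<open>The added term \<open>k = Suc n\<close> vanishes; with it, splitting off
    \<open>k = 0\<close> leaves a shifted sum over \<open>{..n}\<close> that pairs with the sum for
    \<open>a\<close>.\<close>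
  also have "(\<Oplus>k\<in>{..n}. f n k \<otimes> b) = (\<Oplus>k\<in>{..Suc n}. f n k \<otimes> b)"
    by (simp add: f_def binomial_eq_0)
  also have "\<dots> = (\<Oplus>k\<in>{..n}. f n (Suc k) \<otimes> b) \<oplus> f n 0 \<otimes> b"
    by (rule finsum_Suc2) auto
  also have "f n 0 \<otimes> b = f (Suc n) 0"
    by (simp add: f_def)
  also have "(\<Oplus>k\<in>{..n}. f n k \<otimes> a) \<oplus> ((\<Oplus>k\<in>{..n}. f n (Suc k) \<otimes> b) \<oplus> f (Suc n) 0) =
      (\<Oplus>k\<in>{..n}. f n k \<otimes> a \<oplus> f n (Suc k) \<otimes> b) \<oplus> f (Suc n) 0"
    by (subst finsum_addf) (auto simp: a_assoc)
  also have "(\<Oplus>k\<in>{..n}. f n k \<otimes> a \<oplus> f n (Suc k) \<otimes> b) = (\<Oplus>k\<in>{..n}. f (Suc n) (Suc k))"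
    by (intro finsum_cong') (auto simp: *)
  also have "\<dots> \<oplus> f (Suc n) 0 = (\<Oplus>k\<in>{..Suc n}. f (Suc n) k)"
    by (rule finsum_Suc2 [symmetric]) auto
  finally show ?case
    by (simp only: f_def)
qed

text \<open>The prime p divides all binomial coefficients strictly between the ends of row p, and
  p-fold multiples are zero, so only the two outer terms survive.\<close>

lemma (in cring) frobenius_add:
  assumes p: "Factorial_Ring.prime p" "add_pow R p \<one> = \<zero>"
    and [simp]: "a \<in> carrier R" "b \<in> carrier R"
  shows "(a \<oplus> b) [^] (p::nat) = a [^] p \<oplus> b [^] p"
proof -
  have char: "add_pow R (p choose k) x = \<zero>" if "0 < k" "k < p" "x \<in> carrier R" for k x
  proof -
    have "p dvd p choose k"
      by (rule dvd_choose_prime) (use that p in auto)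
    then obtain m where m: "p choose k = p * m" ..
    have "add_pow R (p choose k) x = add_pow R (p choose k) (\<one> \<otimes> x)"
      using that by simp
    also have "\<dots> = add_pow R m (add_pow R p \<one>) \<otimes> x"
      using that by (simp only: m add_pow_ldistr one_closed add.nat_pow_pow add.nat_pow_closed)
    finally show ?thesis
      using that p by simp
  qed
  \<comment> \<open>With \<open>p = Suc (Suc m)\<close>, the indices \<open>Suc k\<close> for
    \<open>k\<close> in \<open>{..m}\<close> are exactly the inner ones 1, ..., p - 1.\<close>
  define m where "m = p - 2"
  have m: "p = Suc (Suc m)"
    using prime_ge_2_nat[OF p(1)] unfolding m_def by linarith
  define f where "f k = add_pow R (p choose k) (a [^] k \<otimes> b [^] (p - k))" for k
  have [simp]: "f k \<in> carrier R" for k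
    by (simp add: f_def)
  have "(a \<oplus> b) [^] p = (\<Oplus>k\<in>{..Suc (Suc m)}. f k)"
    unfolding f_def m by (rule binomial_expansion) simp_all
  also have "\<dots> = f (Suc (Suc m)) \<oplus> ((\<Oplus>k\<in>{..m}. f (Suc k)) \<oplus> f 0)"
    by (subst finsum_Suc, simp, subst finsum_Suc2) auto
  also have "(\<Oplus>k\<in>{..m}. f (Suc k)) = (\<Oplus>k\<in>{..m}. \<zero>)"
    by (intro finsum_cong') (auto simp only: f_def intro!: char, auto simp: m)
  finally show ?thesis
    by (simp add: f_def m)
qed

lemma (in cring) frobenius_iterate_add:
  assumes p: "Factorial_Ring.prime p" "add_pow R p \<one> = \<zero>"
    and [simp]: "a \<in> carrier R" "b \<in> carrier R"
  shows "(a \<oplus> b) [^] (p ^ k::nat) = a [^] (p ^ k) \<oplus> b [^] (p ^ k)"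
proof (induction k)
  case (Suc k)
  have eq: "x [^] (p ^ Suc k) = (x [^] (p ^ k)) [^] p" if "x \<in> carrier R" for x
    using that by (simp add: nat_pow_pow mult.commute)
  show ?case
    using Suc frobenius_add[OF p] by (simp only: eq add.m_closed assms nat_pow_closed)
qed auto

section \<open>Counting the fixed points of a Frobenius power\<close>

lemma (in ring_hom_ring) hom_add_nat_pow:
  "x \<in> carrier R \<Longrightarrow> h (add_pow R (n::nat) x) = add_pow S n (h x)"
  by (induction n) simp_all

text \<open>The fixed points are the roots of \<open>P\<close>. Algebraic closedness gives the
  multiset \<open>roots P\<close> size q, and \<open>simple\<close> turns that size into a
  cardinality.\<close>

lemma (in field) card_frobenius_fixed_points:
  assumes p: "Factorial_Ring.prime p" "add_pow R p \<one> = \<zero>" and k: "k > 0"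
    and closed: "algebraically_closed R"
  shows "card {x \<in> carrier R. x [^] (p ^ k :: nat) = x} = p ^ k"
proof -
  interpret UP: domain "poly_ring R"
    by (rule univ_poly_is_domain[OF carrier_is_subring])
  define q where "q = p ^ k"
  \<comment> \<open>This makes \<open>X\<close> to the power q dominate \<open>X\<close> in
    \<open>deg\<close>, and lets the square of \<open>t\<close> divide its q-th power below.\<close>
  have q: "q > 1"
    unfolding q_def using prime_gt_1_nat[OF p(1)] k by (rule one_less_power)
  have X [simp]: "X \<in> carrier (poly_ring R)"
    by (rule var_closed(1)[OF carrier_is_subring])
  define P where "P = X [^]\<^bsub>poly_ring R\<^esub> q \<ominus>\<^bsub>poly_ring R\<^esub> X"
  have P [simp]: "P \<in> carrier (poly_ring R)"
    by (simp add: P_def)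
  interpret const: ring_hom_ring R "poly_ring R" poly_of_const
    using canonical_embedding_ring_hom[OF carrier_is_subring] by simp
  \<comment> \<open>The characteristic carries over to polynomials, so that Frobenius applies to
    \<open>X\<close> plus a constant.\<close>
  have p': "add_pow (poly_ring R) p \<one>\<^bsub>poly_ring R\<^esub> = \<zero>\<^bsub>poly_ring R\<^esub>"
    using const.hom_add_nat_pow[of \<one> p] p(2) by simp
  have deg: "degree P = q"
  proof -
    have "degree (X [^]\<^bsub>poly_ring R\<^esub> q) = q"
      using polynomial_pow_degree[OF X, of q] by (simp add: var_def)
    moreover have "degree (\<ominus>\<^bsub>poly_ring R\<^esub> X) = 1"
      by (simp add: univ_poly_a_inv_def'[OF carrier_is_subring X], simp add: var_def)
    ultimately show ?thesis
      using poly_add_degree_eq[OF carrier_is_subring, of "X [^]\<^bsub>poly_ring R\<^esub> q" "\<ominus>\<^bsub>poly_ring R\<^esub> X"] q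
      by (simp add: P_def a_minus_def univ_poly_add univ_poly_carrier)
  qed
  have eval: "eval P x = x [^] q \<ominus> x" if x: "x \<in> carrier R" for x
  proof -
    interpret ev: ring_hom_ring "poly_ring R" R "\<lambda>p. eval p x"
      by (rule eval_ring_hom[OF carrier_is_subring x])
    have "eval X x = x"
      by (rule eval_var[OF x])
    then show ?thesis
      by (simp add: P_def ev.hom_nat_pow a_minus_def)
  qed
  have "P \<noteq> []"
    using deg q by auto
  have root: "a \<in># roots P \<longleftrightarrow> a \<in> carrier R \<and> a [^] q = a" for a
    using \<open>P \<noteq> []\<close> eval by (auto simp: roots_mem_iff_is_root is_root_def)
  have simple: "count (roots P) a \<le> 1" for a
  proof (rule ccontr)
    assume "\<not> count (roots P) a \<le> 1"
    then have mult: "2 \<le> alg_mult P a" and "a \<in># roots P"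
      by (auto simp: alg_mult_eq_count_roots simp flip: count_greater_zero_iff)
    then have a [simp]: "a \<in> carrier R" and aq: "a [^] q = a"
      by (auto simp: root)
    \<comment> \<open>The polynomial X - a, leading coefficient first.\<close>
    define t where "t = [\<one>, \<ominus> a]"
    have t [simp]: "t \<in> carrier (poly_ring R)"
      unfolding t_def sym[OF univ_poly_carrier] polynomial_def by simp
    define c where "c = poly_of_const (\<ominus> a)"
    have c [simp]: "c \<in> carrier (poly_ring R)"
      by (simp add: c_def)
    \<comment> \<open>Additivity applied to a + (-a) = 0 gives (-a)^q = -a without separating odd
      from even q.\<close>
    have "a [^] q \<oplus> (\<ominus> a) [^] q = (a \<oplus> \<ominus> a) [^] q"
      using frobenius_iterate_add[OF p, of a "\<ominus> a" k] by (simp add: q_def)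
    also have "\<dots> = \<zero>"
      using q by (simp add: r_neg nat_pow_zero)
    finally have "(\<ominus> a) [^] q = \<ominus> a"
      using aq by (metis a a_comm add.inv_closed minus_equality nat_pow_closed)
    then have cq: "c [^]\<^bsub>poly_ring R\<^esub> q = c"
      unfolding c_def using const.hom_nat_pow[of "\<ominus> a" q] by simp
    have t_eq: "t = X \<oplus>\<^bsub>poly_ring R\<^esub> c"
      by (simp add: t_def c_def poly_of_const_def var_def univ_poly_add)
    have tq: "t [^]\<^bsub>poly_ring R\<^esub> q = X [^]\<^bsub>poly_ring R\<^esub> q \<oplus>\<^bsub>poly_ring R\<^esub> c"
      unfolding t_eq using UP.frobenius_iterate_add[OF p(1) p' X c, of k] cq by (simp add: q_def)
    let ?t2 = "t [^]\<^bsub>poly_ring R\<^esub> (2::nat)"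
    have "?t2 pdivides P"
      using le_alg_mult_imp_pdivides[OF a P mult] by (simp add: t_def)
    then obtain u where u: "u \<in> carrier (poly_ring R)" "P = ?t2 \<otimes>\<^bsub>poly_ring R\<^esub> u"
      by (auto simp: pdivides_def)
    have "?t2 pdivides (t [^]\<^bsub>poly_ring R\<^esub> q)"
      using polynomial_pow_division[OF t, of 2 q] q by simp
    then obtain v where v: "v \<in> carrier (poly_ring R)" "t [^]\<^bsub>poly_ring R\<^esub> q = ?t2 \<otimes>\<^bsub>poly_ring R\<^esub> v"
      by (auto simp: pdivides_def)
    \<comment> \<open>Since t^q = X^q - a, subtracting P leaves X - a = t. Hence t^2, dividing both
      t^q and P, would divide t, against the degrees 2 and 1.\<close>
    have "X \<oplus>\<^bsub>poly_ring R\<^esub> c = (X [^]\<^bsub>poly_ring R\<^esub> q \<oplus>\<^bsub>poly_ring R\<^esub> c)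
        \<ominus>\<^bsub>poly_ring R\<^esub> (X [^]\<^bsub>poly_ring R\<^esub> q \<ominus>\<^bsub>poly_ring R\<^esub> X)"
      using X c UP.nat_pow_closed[OF X, of q] by algebra
    then have "t = t [^]\<^bsub>poly_ring R\<^esub> q \<ominus>\<^bsub>poly_ring R\<^esub> P"
      by (simp only: P_def tq, simp only: t_eq)
    also have "\<dots> = ?t2 \<otimes>\<^bsub>poly_ring R\<^esub> (v \<ominus>\<^bsub>poly_ring R\<^esub> u)"
      unfolding u(2) v(2) using u(1) v(1) t UP.nat_pow_closed[OF t, of 2] by algebra
    finally have "?t2 pdivides t"
      unfolding pdivides_def by (rule dividesI[rotated]) (use u v in simp)
    then have "degree ?t2 \<le> degree t"
      by (intro pdivides_imp_degree_le[OF carrier_is_subring]) (simp_all, simp add: t_def)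
    then show False
      using polynomial_pow_degree[OF t, of 2] by (simp add: t_def)
  qed
  have "set_mset (roots P) = {x \<in> carrier R. x [^] q = x}"
    by (auto simp: root)
  moreover have "roots P = mset_set (set_mset (roots P))"
  proof (rule multiset_eqI)
    fix a
    show "count (roots P) a = count (mset_set (set_mset (roots P))) a"
      using simple[of a] by (cases "a \<in># roots P") (auto simp: not_in_iff count_mset_set' le_Suc_eq simp flip: count_greater_zero_iff)
  qed
  moreover have "size (roots P) = q"
    using algebraically_closed.roots_over_carrier[OF closed P] deg by (simp add: splitted_def)
  ultimately show ?thesis
    unfolding q_def by (metis size_mset_set)
qed


section \<open>Almost disjoint families: relabelling and upper bounds\<close>

text \<open>Lets a plane with at most n points and at least m lines be used directly: the points are
  injected into \<open>{1..n}\<close> and surplus lines are dropped.\<close>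

lemma almost_disjoint_family_transfer:
  assumes P: "finite P" "card P \<le> n" and F: "m \<le> card F"
    and sub: "\<And>A. A \<in> F \<Longrightarrow> A \<subseteq> P \<and> card A = k"
    and int: "\<And>A B. A \<in> F \<Longrightarrow> B \<in> F \<Longrightarrow> A \<noteq> B \<Longrightarrow> card (A \<inter> B) \<le> 1"
  shows "\<exists>G. almost_disjoint_family n m k G"
proof -
  have "finite F"
    using P sub by (meson Sup_le_iff finite_UnionD finite_subset)
  then obtain H where H: "H \<subseteq> F" "finite H" "card H = m"
    using F obtain_subset_with_card_n by metis
  obtain f where f: "inj_on f P" "f ` P \<subseteq> {1..n}"
    using P card_le_inj[of P "{1..n}"] by auto
  have inj: "inj_on f (A \<union> B)" if "A \<in> H" "B \<in> H" for A B
    using that sub H f by (meson Un_least inj_on_subset subsetD)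
  have card: "card (f ` A) = card A" if "A \<in> H" for A
    using inj[OF that that] by (simp add: card_image)
  have imInt: "f ` A \<inter> f ` B = f ` (A \<inter> B)" if "A \<in> H" "B \<in> H" for A B
    using inj[OF that] by (simp add: inj_on_image_Int[where C = "A \<union> B"])
  have injH: "inj_on ((`) f) H"
  proof (rule inj_onI)
    fix A B assume "A \<in> H" "B \<in> H" "f ` A = f ` B"
    then show "A = B"
      using inj[of A B] by (simp add: inj_on_image_eq_iff[where C = "A \<union> B"])
  qed
  have "almost_disjoint_family n m k ((`) f ` H)"
    unfolding almost_disjoint_family_def
  proof (intro conjI ballI impI)
    show "card ((`) f ` H) = m"
      using injH H by (simp add: card_image)
  next
    fix A B assume AB: "A \<in> (`) f ` H" "B \<in> (`) f ` H" "A \<noteq> B"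
    then obtain A' B' where *: "A = f ` A'" "B = f ` B'" "A' \<in> H" "B' \<in> H" "A' \<noteq> B'"
      by blast
    have "card (A \<inter> B) = card (f ` (A' \<inter> B'))"
      using * imInt by simp
    also have "\<dots> = card (A' \<inter> B')"
      using inj[of A' B'] * by (intro card_image) (auto simp: inj_on_def)
    also have "\<dots> \<le> 1"
      using int * H by blast
    finally show "card (A \<inter> B) \<le> 1" .
  qed (use H sub card f in \<open>fastforce+\<close>)
  then show ?thesis ..
qed

text \<open>Distinct members have disjoint sets \<open>T A\<close> of pairs, as a common pair would
  put two elements into their intersection; all these pairs lie in \<open>{1..n}\<close>.\<close>

lemma almost_disjoint_family_bound:
  assumes "almost_disjoint_family n m k F"
  shows "m * (k choose 2) \<le> n choose 2"
proof -
  define T where "T A = {p. p \<subseteq> A \<and> card p = 2}" for A :: "nat set"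
  have F: "finite F" "card F = m" "\<And>A. A \<in> F \<Longrightarrow> A \<subseteq> {1..n} \<and> card A = k"
    "\<And>A B. A \<in> F \<Longrightarrow> B \<in> F \<Longrightarrow> A \<noteq> B \<Longrightarrow> card (A \<inter> B) \<le> 1"
    using assms unfolding almost_disjoint_family_def by auto
  have fin: "finite A" if "A \<in> F" for A
    using F(3)[OF that] finite_subset by blast
  have cardT: "card (T A) = k choose 2" if "A \<in> F" for A
    unfolding T_def using n_subsets[OF fin[OF that], of 2] F(3)[OF that] by simp
  have "T A \<inter> T B = {}" if AB: "A \<in> F" "B \<in> F" "A \<noteq> B" for A B
  proof (rule ccontr)
    assume "T A \<inter> T B \<noteq> {}"
    then obtain p where "p \<subseteq> A \<inter> B" "card p = 2"
      by (auto simp: T_def)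
    then have "2 \<le> card (A \<inter> B)"
      using fin[OF that(1)] card_mono[of "A \<inter> B" p] by simp
    then show False
      using F(4)[OF that] by simp
  qed
  then have "m * (k choose 2) = card (\<Union>A\<in>F. T A)"
    using F(1,2) fin cardT by (subst card_UN_disjoint) (auto simp: T_def)
  also have "\<dots> \<le> card (T {1..n})"
    using F(3) by (intro card_mono) (auto simp: T_def)
  also have "\<dots> = n choose 2"
    unfolding T_def by (simp add: n_subsets)
  finally show ?thesis .
qed

lemma almost_disjoint_family_square_bound:
  assumes "almost_disjoint_family n n k F" "n > 0"
  shows "k * (k - 1) < n"
proof -
  have "n * (k choose 2) \<le> n choose 2"
    by (rule almost_disjoint_family_bound[OF assms(1)])
  then have "n * (2 * (k choose 2)) \<le> 2 * (n choose 2)"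
    by simp
  moreover have "2 * (r choose 2) = r * (r - 1)" for r :: nat
    by (cases r) (simp_all add: choose_two)
  ultimately have "n * (k * (k - 1)) \<le> n * (n - 1)"
    by simp
  \<comment> \<open>Cancelling the positive factor n leaves k (k - 1) \<le> n - 1.\<close>
  then show ?thesis
    using assms(2) by auto
qed

text \<open>Any k > q would give k (k - 1) \<ge> (q + 1) q \<ge> n, contradicting the pair count.
  This also bounds the set of sizes, so its \<open>Max\<close> is a genuine maximum.\<close>

lemma kappa_le1_eqI:
  assumes n: "n > 0" and ex: "\<exists>F. almost_disjoint_family n n q F" and q: "n \<le> q * (q + 1)"
  shows "kappa_le1 n n = q"
proof -
  have le: "k \<le> q" if "almost_disjoint_family n n k F" for k F
  proof (rule ccontr)
    assume "\<not> k \<le> q"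
    then have "(q + 1) * q \<le> k * (k - 1)"
      by (intro mult_le_mono) auto
    then show False
      using almost_disjoint_family_square_bound[OF that n] q by (simp add: mult.commute)
  qed
  then have "finite {k. \<exists>F. almost_disjoint_family n n k F}"
    by (auto intro: finite_subset[of _ "{..q}"])
  then show ?thesis
    unfolding kappa_le1_def using ex le by (intro Max_eqI) auto
qed

section \<open>Affine and projective planes from coordinates\<close>

text \<open>\<open>f m b x\<close> stands for $m x + b$; only the incidence properties of these graphs matter.\<close>

locale coordinate_plane =
  fixes S :: "'a set" and f :: "'a \<Rightarrow> 'a \<Rightarrow> 'a \<Rightarrow> 'a"
  assumes finite: "finite S" and card_gt_1: "card S > 1"
    and closed: "m \<in> S \<Longrightarrow> b \<in> S \<Longrightarrow> x \<in> S \<Longrightarrow> f m b x \<in> S"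
    and parallel: "\<lbrakk>m \<in> S; b \<in> S; b' \<in> S; x \<in> S; f m b x = f m b' x\<rbrakk> \<Longrightarrow> b = b'"
    and meet: "\<lbrakk>m \<in> S; m' \<in> S; m \<noteq> m'; b \<in> S; b' \<in> S; x \<in> S; x' \<in> S;
      f m b x = f m' b' x; f m b x' = f m' b' x'\<rbrakk> \<Longrightarrow> x = x'"
begin

fun line :: "'a \<times> 'a + 'a \<Rightarrow> ('a \<times> 'a) set" where
  "line (Inl (m, b)) = (\<lambda>x. (x, f m b x)) ` S"
| "line (Inr c) = Pair c ` S"

text \<open>The parallel class of a line, with \<open>None\<close> for the vertical lines. These
  classes later serve as the points at infinity.\<close>

fun direction :: "'a \<times> 'a + 'a \<Rightarrow> 'a option" where
  "direction (Inl (m, b)) = Some m"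
| "direction (Inr c) = None"

definition indices :: "('a \<times> 'a + 'a) set" where
  "indices = (S \<times> S) <+> S"

definition directions :: "'a option set" where
  "directions = insert None (Some ` S)"

definition projective_line :: "'a \<times> 'a + 'a \<Rightarrow> ('a \<times> 'a + 'a option) set" where
  "projective_line i = Inl ` line i \<union> {Inr (direction i)}"

lemma finite_indices [simp]: "finite indices"
  using finite by (simp add: indices_def)

lemma card_indices: "card indices = (card S)\<^sup>2 + card S"
  using finite by (simp add: indices_def card_Plus card_cartesian_product power2_eq_square)

lemma line_subset: "i \<in> indices \<Longrightarrow> line i \<subseteq> S \<times> S"
  using closed by (auto simp: indices_def)

lemma finite_line [simp]: "i \<in> indices \<Longrightarrow> finite (line i)"
  using finite by (auto simp: indices_def)

lemma direction_in: "i \<in> indices \<Longrightarrow> direction i \<in> directions"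
  by (auto simp: indices_def directions_def)

lemma card_line: "i \<in> indices \<Longrightarrow> card (line i) = card S"
  by (auto simp: indices_def intro!: card_image inj_onI)

text \<open>For two sloped lines with a common point, equal slopes would force equal intercepts by
  \<open>parallel\<close>; so the slopes differ and \<open>meet\<close> applies. A vertical line
  fixes the abscissa, hence meets a sloped line at most once and another vertical line
  never.\<close>

lemma line_Int_point:
  assumes "i \<in> indices" "j \<in> indices" "i \<noteq> j" "p \<in> line i \<inter> line j" "p' \<in> line i \<inter> line j"
  shows "p = p'" "direction i \<noteq> direction j"
proof -
  have *: "p = p' \<and> direction i \<noteq> direction j"
  proof (cases i)
    case (Inl mb)
    show ?thesis
    proof (cases j)
      case (Inl mb')
      with \<open>i = Inl mb\<close> obtain m b m' b' where ij: "i = Inl (m, b)" "j = Inl (m', b')"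
        by (metis surj_pair)
      then have S: "m \<in> S" "b \<in> S" "m' \<in> S" "b' \<in> S"
        using assms by (auto simp: indices_def)
      obtain x x' where x: "x \<in> S" "x' \<in> S" "p = (x, f m b x)" "p' = (x', f m b x')"
          "f m b x = f m' b' x" "f m b x' = f m' b' x'"
        using assms ij by auto
      then have "m \<noteq> m'"
        using parallel[of m b b' x] S ij assms(3) by auto
      then show ?thesis
        using meet[of m m' b b' x x'] S x ij by auto
    qed (use assms Inl in \<open>cases mb; auto\<close>)
  qed (use assms in \<open>cases j; auto simp: indices_def\<close>)
  show "p = p'" "direction i \<noteq> direction j"
    using * by auto
qed

text \<open>The bound is 0 exactly when the two lines will share a point at infinity, which keeps
  the projective total at most 1.\<close>

lemma card_line_Int:
  assumes "i \<in> indices" "j \<in> indices" "i \<noteq> j"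
  shows "card (line i \<inter> line j) \<le> (if direction i = direction j then 0 else 1)"
proof -
  have "line i \<inter> line j = {} \<or> (\<exists>p. line i \<inter> line j = {p}) \<and> direction i \<noteq> direction j"
    using line_Int_point[OF assms] by blast
  then show ?thesis by auto
qed

text \<open>Lines with equal point sets would intersect in \<open>card S > 1\<close> points.\<close>

lemma inj_line: "inj_on line indices"
proof (rule inj_onI, rule ccontr)
  fix i j assume *: "i \<in> indices" "j \<in> indices" "line i = line j" "i \<noteq> j"
  then have "card S \<le> (if direction i = direction j then 0 else 1)"
    using card_line_Int[of i j] by (simp add: card_line)
  then show False
    using card_gt_1 by (simp split: if_splits)
qed

text \<open>The affine plane has q^2 points and q^2 + q lines for q = \<open>card S\<close>; the two
  hypotheses say that the points fit into [n] and that there are enough lines.\<close>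

lemma affine_family:
  assumes "(card S)\<^sup>2 \<le> n" "n \<le> (card S)\<^sup>2 + card S"
  shows "\<exists>F. almost_disjoint_family n n (card S) F"
proof (rule almost_disjoint_family_transfer)
  show "finite (S \<times> S)" "card (S \<times> S) \<le> n"
    using finite assms by (auto simp: card_cartesian_product power2_eq_square)
  show "n \<le> card (line ` indices)"
    using assms by (simp add: card_image[OF inj_line] card_indices)
  show "A \<subseteq> S \<times> S \<and> card A = card S" if "A \<in> line ` indices" for A
    using that line_subset card_line by blast
  show "card (A \<inter> B) \<le> 1" if AB: "A \<in> line ` indices" "B \<in> line ` indices" "A \<noteq> B" for A B
  proof -
    obtain i j where "i \<in> indices" "j \<in> indices" "i \<noteq> j" "A = line i" "B = line j"
      using AB by blast
    then show ?thesis
      using card_line_Int[of i j] by (simp split: if_splits)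
  qed
qed

lemma card_projective_line:
  "i \<in> indices \<Longrightarrow> card (projective_line i) = card S + 1"
  unfolding projective_line_def
  by (subst card_Un_disjoint) (auto simp: card_image card_line)

lemma card_projective_line_Int:
  assumes "i \<in> indices" "j \<in> indices" "i \<noteq> j"
  shows "card (projective_line i \<inter> projective_line j) \<le> 1"
proof -
  have "projective_line i \<inter> projective_line j =
      Inl ` (line i \<inter> line j) \<union> (if direction i = direction j then {Inr (direction i)} else {})"
    by (auto simp: projective_line_def)
  also have "card \<dots> \<le> card (line i \<inter> line j) + (if direction i = direction j then 1 else 0)"
    by (intro order.trans[OF card_Un_le]) (auto simp: card_image)
  also have "\<dots> \<le> 1"
    using card_line_Int[OF assms] by (simp split: if_splits)
  finally show ?thesis .
qed

text \<open>Adjoining the q + 1 directions as points, together with the line at infinity through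
  them, raises both counts to q^2 + q + 1 and the line size to q + 1.\<close>

lemma projective_family:
  "\<exists>F. almost_disjoint_family ((card S)\<^sup>2 + card S + 1) ((card S)\<^sup>2 + card S + 1) (card S + 1) F"
proof -
  define infinity :: "('a \<times> 'a + 'a option) set" where "infinity = Inr ` directions"
  define P where "P = Inl ` (S \<times> S) \<union> infinity"
  define F where "F = insert infinity (projective_line ` indices)"
  have dir: "finite directions" "card directions = card S + 1"
    using finite by (auto simp: directions_def card_image)
  have infinity: "finite infinity" "card infinity = card S + 1"
    using dir by (auto simp: infinity_def card_image)
  have P: "finite P" "card P \<le> (card S)\<^sup>2 + card S + 1"
  proof -
    show "finite P"
      using finite infinity by (simp add: P_def)
    have "card P \<le> card (Inl ` (S \<times> S) :: ('a \<times> 'a + 'a option) set) + card infinity"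
      unfolding P_def by (rule card_Un_le)
    then show "card P \<le> (card S)\<^sup>2 + card S + 1"
      using infinity by (simp add: card_image card_cartesian_product power2_eq_square)
  qed
  have infinity_Int: "card (infinity \<inter> projective_line i) \<le> 1" for i
  proof -
    have "infinity \<inter> projective_line i \<subseteq> {Inr (direction i)}"
      by (auto simp: projective_line_def infinity_def)
    then have "card (infinity \<inter> projective_line i) \<le> card {Inr (direction i) :: 'a \<times> 'a + 'a option}"
      by (intro card_mono) simp_all
    then show ?thesis by simp
  qed
  have inj: "inj_on projective_line indices"
  proof (rule inj_onI, rule ccontr)
    fix i j assume *: "i \<in> indices" "j \<in> indices" "projective_line i = projective_line j" "i \<noteq> j"
    then have "card S + 1 \<le> 1"
      using card_projective_line_Int[of i j] card_projective_line[of j] by simp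
    then show False
      using card_gt_1 by simp
  qed
  \<comment> \<open>Otherwise the intersection would have q + 1 > 1 points, whereas a line has a
    single direction.\<close>
  have "infinity \<noteq> projective_line i" for i
    using infinity_Int[of i] infinity card_gt_1 by auto
  then have "infinity \<notin> projective_line ` indices"
    by blast
  then have "card F = (card S)\<^sup>2 + card S + 1"
    using inj by (simp add: F_def card_image card_indices)
  moreover have "A \<subseteq> P \<and> card A = card S + 1" if A: "A \<in> F" for A
  proof (cases "A = infinity")
    case True
    then show ?thesis
      using infinity by (simp add: P_def)
  next
    case False
    then obtain i where i: "i \<in> indices" "A = projective_line i"
      using A by (auto simp: F_def)
    have "Inr (direction i) \<in> infinity"
      using direction_in[OF i(1)] by (simp add: infinity_def)
    then show ?thesis
      using line_subset[OF i(1)] card_projective_line[OF i(1)]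
      by (auto simp: i(2) projective_line_def P_def)
  qed
  moreover have "card (A \<inter> B) \<le> 1" if AB: "A \<in> F" "B \<in> F" "A \<noteq> B" for A B
  proof -
    consider "A = infinity" "B \<in> projective_line ` indices"
      | "B = infinity" "A \<in> projective_line ` indices"
      | "A \<in> projective_line ` indices" "B \<in> projective_line ` indices"
      using AB by (auto simp: F_def)
    then show ?thesis
    proof cases
      case 3
      then obtain i j where "i \<in> indices" "j \<in> indices" "A = projective_line i" "B = projective_line j"
        by blast
      then show ?thesis
        using card_projective_line_Int[of i j] AB(3) by auto
    qed (use infinity_Int in \<open>auto simp: Int_commute\<close>)
  qed
  ultimately show ?thesis
    using P by (intro almost_disjoint_family_transfer[of P _ _ F]) simp_all
qed

end


section \<open>Coordinates of prime power order\<close>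

text \<open>The element type of \<open>S\<close> is that of \<open>alg_closure\<close> over the
  integers modulo p.\<close>

lemma coordinate_plane_exists:
  assumes "primepow q"
  obtains S :: "((int list \<times> nat) multiset \<Rightarrow> int) set" and f
  where "coordinate_plane S f" "card S = q"
proof -
  obtain p k where p: "Factorial_Ring.prime p" and k: "k > 0" and q: "q = p ^ k"
    using assms by (auto simp: primepow_def)
  let ?R = "residue_ring (int p)"
  interpret R: residues_prime p ?R
    using p by (simp add: residues_prime_def)
  have one: "add_pow ?R n \<one>\<^bsub>?R\<^esub> = int n mod int p" for n :: nat
    by (induction n) (simp_all add: R.res_zero_eq R.res_one_eq R.res_add_eq add.commute mod_simps)
  define L where "L = R.alg_closure"
  interpret L: algebraic_closure L "R.indexed_const ` carrier ?R"
    unfolding L_def by (rule R.alg_closureE)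
  interpret h: ring_hom_ring ?R L R.indexed_const
    by (intro ring_hom_ringI2 R.ring_axioms L.ring_axioms R.alg_closureE(2)[folded L_def])
  \<comment> \<open>The embedding \<open>R.indexed_const\<close> carries p times 1 = 0 from the
    residue ring into the closure.\<close>
  have char: "add_pow L p \<one>\<^bsub>L\<^esub> = \<zero>\<^bsub>L\<^esub>"
    using h.hom_add_nat_pow[of "\<one>\<^bsub>?R\<^esub>" p] one[of p] by (simp flip: R.res_zero_eq)
  define S where "S = {x \<in> carrier L. x [^]\<^bsub>L\<^esub> q = x}"
  have card: "card S = q"
    unfolding S_def q by (rule L.card_frobenius_fixed_points[OF p char k L.algebraically_closed_axioms])
  define f where "f m b x = m \<otimes>\<^bsub>L\<^esub> x \<oplus>\<^bsub>L\<^esub> b" for m b x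
  have "coordinate_plane S f"
  proof
    show "card S > 1"
      using card primepow_gt_Suc_0[OF assms] by simp
    \<comment> \<open>An infinite set has \<open>card\<close> 0, so the computed cardinality already
      yields finiteness.\<close>
    then show "finite S"
      by (simp add: card_ge_0_finite)
  next
    fix m b x assume "m \<in> S" "b \<in> S" "x \<in> S"
    then show "f m b x \<in> S"
      using L.frobenius_iterate_add[OF p char, of "m \<otimes>\<^bsub>L\<^esub> x" b k]
      by (simp add: S_def f_def L.nat_pow_distrib q)
  next
    fix m b b' x assume "m \<in> S" "b \<in> S" "b' \<in> S" "x \<in> S" "f m b x = f m b' x"
    then show "b = b'"
      by (auto simp: S_def f_def L.add.l_cancel)
  next
    fix m m' b b' x x'
    assume mem: "m \<in> S" "m' \<in> S" "b \<in> S" "b' \<in> S" "x \<in> S" "x' \<in> S" and "m \<noteq> m'"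
      and eq: "f m b x = f m' b' x" "f m b x' = f m' b' x'"
    have carr: "m \<in> carrier L" "m' \<in> carrier L" "b \<in> carrier L" "b' \<in> carrier L"
        "x \<in> carrier L" "x' \<in> carrier L"
      using mem by (auto simp: S_def)
    \<comment> \<open>Subtracting the two incidence equations gives (m - m') (x - x') = 0, and
      \<open>L\<close> has no zero divisors.\<close>
    have "(m \<ominus>\<^bsub>L\<^esub> m') \<otimes>\<^bsub>L\<^esub> (x \<ominus>\<^bsub>L\<^esub> x') =
        ((m \<otimes>\<^bsub>L\<^esub> x \<oplus>\<^bsub>L\<^esub> b) \<ominus>\<^bsub>L\<^esub> (m' \<otimes>\<^bsub>L\<^esub> x \<oplus>\<^bsub>L\<^esub> b'))
        \<ominus>\<^bsub>L\<^esub> ((m \<otimes>\<^bsub>L\<^esub> x' \<oplus>\<^bsub>L\<^esub> b) \<ominus>\<^bsub>L\<^esub> (m' \<otimes>\<^bsub>L\<^esub> x' \<oplus>\<^bsub>L\<^esub> b'))"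
      using carr by algebra
    also have "\<dots> = \<zero>\<^bsub>L\<^esub>"
      using eq carr by (simp add: f_def L.minus_eq L.r_neg)
    finally have "x \<ominus>\<^bsub>L\<^esub> x' = \<zero>\<^bsub>L\<^esub>"
      using \<open>m \<noteq> m'\<close> carr by (simp add: L.integral_iff)
    then show "x = x'"
      using carr by simp
  qed
  with card show ?thesis
    using that by blast
qed

theorem theorem3p5:
  fixes q n :: nat
  assumes "primepow q" and "n > 0"
  shows "(q\<^sup>2 \<le> n \<and> n \<le> q\<^sup>2 + q \<longrightarrow> kappa_le1 n n = q) \<and>
         (n = q\<^sup>2 + q + 1 \<longrightarrow> kappa_le1 n n = q + 1)"
proof -
  obtain S :: "((int list \<times> nat) multiset \<Rightarrow> int) set" and f
    where plane: "coordinate_plane S f" and q: "card S = q"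
    using coordinate_plane_exists[OF assms(1)] .
  show ?thesis
  proof (intro conjI impI)
    assume "q\<^sup>2 \<le> n \<and> n \<le> q\<^sup>2 + q"
    then show "kappa_le1 n n = q"
      \<comment> \<open>The upper end q^2 + q of the range is exactly the limit q (q + 1) in
        \<open>kappa_le1_eqI\<close>.\<close>
      using coordinate_plane.affine_family[OF plane, of n] assms(2)
      by (intro kappa_le1_eqI) (simp_all add: q power2_eq_square)
  next
    assume "n = q\<^sup>2 + q + 1"
    then show "kappa_le1 n n = q + 1"
      \<comment> \<open>Here \<open>kappa_le1_eqI\<close> is applied with q + 1 for its
        \<open>q\<close>; its limit (q + 1) (q + 2) exceeds q^2 + q + 1.\<close>
      using coordinate_plane.projective_family[OF plane]
      by (intro kappa_le1_eqI) (simp_all add: q power2_eq_square)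
  qed
qed

end
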